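(* Let $n\ge 1$, let $\mathbf{p}=(p_1,\dots,p_n)$ with $p_i>0$ for all $i$ and $\sum_{i=1}^n p_i=1$, let $\alpha_n>0$, and let $f_0(x)=\sum_{i=1}^n p_i\delta_{\xi_i}(x)$ be a discrete density with $n$ atoms $\xi_1,\dots,\xi_n$. Let $\mathbf{w}=(w_1,\dots,w_n)\sim\mathrm{Dir}(\alpha_n\mathbf{p})$ and $f(x)=\sum_{i=1}^n w_i\delta_{\xi_i}(x)$. Then the Kullback-Leibler divergence $\mathrm{KL}(f_0\,||\,f)=\sum_{i=1}^n p_i\log\left(\frac{p_i}{w_i}\right)$ has mean and variance $$\mathrm{E}\{\mathrm{KL}(f_0\,||\,f)\}=H(\mathbf{p})-\sum_{i=1}^n p_i\left\{\psi_0(\alpha_n p_i)-\psi_0(\alpha_n)\right\},$$ $$\mathrm{Var}\{\mathrm{KL}(f_0\,||\,f)\}=\sum_{i=1}^n p_i^2\,\psi_1(\alpha_n p_i)-\psi_1(\alpha_n),$$ where $H(\mathbf{p})=\sum_{i=1}^n p_i\log p_i$.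
   Context: $\mathrm{Dir}(\alpha_n\mathbf{p})$ is the Dirichlet distribution with parameter vector $(\alpha_n p_1,\dots,\alpha_n p_n)$. $\psi_0(x)=\frac{d}{dx}\log\Gamma(x)$ is the digamma function and $\psi_1(x)=\frac{d^2}{dx^2}\log\Gamma(x)$ the trigamma function. Note the sign convention $H(\mathbf{p})=\sum_i p_i\log p_i$ (no minus sign). *)

theory Defs
  imports "HOL-Probability.Probability"
begin

text \<open>
  The Dirichlet distribution with parameters \<open>a 1, \<dots>, a n\<close> is given by its usual density with
  respect to Lebesgue measure in the first \<open>n - 1\<close> coordinates, the last one being determined by
  \<open>x 1 + \<dots> + x n = 1\<close>. For \<open>n = 1\<close> the base measure is the point mass on the empty vector, so
  the distribution is the point mass at \<open>x 1 = 1\<close>.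
\<close>

definition simplex_point :: "nat \<Rightarrow> (nat \<Rightarrow> real) \<Rightarrow> nat \<Rightarrow> real" where
  "simplex_point n x = (\<lambda>i\<in>{1..n}. if i = n then 1 - (\<Sum>j\<in>{1..<n}. x j) else x i)"

definition dirichlet_density :: "nat \<Rightarrow> (nat \<Rightarrow> real) \<Rightarrow> (nat \<Rightarrow> real) \<Rightarrow> real" where
  "dirichlet_density n a x =
     (if \<forall>i\<in>{1..n}. 0 < x i
      then Gamma (\<Sum>i\<in>{1..n}. a i) / (\<Prod>i\<in>{1..n}. Gamma (a i)) *
             (\<Prod>i\<in>{1..n}. x i powr (a i - 1))
      else 0)"

definition dirichlet :: "nat \<Rightarrow> (nat \<Rightarrow> real) \<Rightarrow> (nat \<Rightarrow> real) measure" where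
  "dirichlet n a =
     distr
       (density (Pi\<^sub>M {1..<n} (\<lambda>_. lborel))
          (\<lambda>x. ennreal (dirichlet_density n a (simplex_point n x))))
       (Pi\<^sub>M {1..n} (\<lambda>_. borel))
       (simplex_point n)"

definition atomic_measure :: "nat \<Rightarrow> (nat \<Rightarrow> 'b) \<Rightarrow> (nat \<Rightarrow> real) \<Rightarrow> 'b measure" where
  "atomic_measure n \<xi> c =
     point_measure UNIV (\<lambda>x. ennreal (\<Sum>i\<in>{1..n}. c i * indicator {\<xi> i} x))"

text \<open>
  \<open>KL_divergence b M N\<close> integrates with respect to \<open>N\<close>, so the divergence of \<open>f\<close> from \<open>f\<^sub>0\<close>
  has \<open>f\<^sub>0\<close> as its last argument. The base \<open>exp 1\<close> makes the logarithm natural.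
\<close>

definition kl_atoms :: "nat \<Rightarrow> (nat \<Rightarrow> 'b) \<Rightarrow> (nat \<Rightarrow> real) \<Rightarrow> (nat \<Rightarrow> real) \<Rightarrow> real" where
  "kl_atoms n \<xi> p w =
     KL_divergence (exp 1) (atomic_measure n \<xi> w) (atomic_measure n \<xi> p)"

text \<open>Without the minus sign of the Shannon entropy.\<close>

definition H :: "nat \<Rightarrow> (nat \<Rightarrow> real) \<Rightarrow> real" where
  "H n p = (\<Sum>i\<in>{1..n}. p i * ln (p i))"

text \<open>\<open>Digamma\<close> and \<open>Polygamma 1\<close> are the first two derivatives of \<open>log \<circ> \<Gamma>\<close>.\<close>

lemma deriv_ln_Gamma_eq_Digamma:
  fixes x :: real
  assumes "0 < x"
  shows "((\<lambda>t. ln (Gamma t)) has_field_derivative Digamma x) (at x)"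
proof (subst DERIV_cong_ev[OF refl _ refl])
  show "\<forall>\<^sub>F t in nhds x. ln (Gamma t) = ln_Gamma t"
    using eventually_nhds_in_open[of "{0<..}" x] assms
    by (auto elim!: eventually_mono simp: Gamma_real_pos_exp)
qed (use assms in \<open>rule has_field_derivative_ln_Gamma_real\<close>)

lemma deriv_Digamma_eq_trigamma:
  fixes x :: real
  assumes "0 < x"
  shows "(Digamma has_field_derivative Polygamma 1 x) (at x)"
  using has_field_derivative_Polygamma[of x 0 UNIV] assms
  by (auto simp: nonpos_Ints_def)

end

theory Submission
  imports Defs
begin

text \<open>
  The divergence \<open>X = \<Sum>i. p i * ln (p i / w i)\<close> has an explicit moment generating function:
  \<open>exp (s * X) = exp (s * H p) * (\<Prod>i. w i powr (- s * p i))\<close>, and multiplying the Dirichlet density with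
  parameters \<open>\<alpha> * p i\<close> by this product gives, up to normalisation, the Dirichlet density with
  parameters \<open>(\<alpha> - s) * p i\<close>. Hence the cumulant generating function of \<open>X\<close> is, for \<open>\<bar>s\<bar> < \<alpha>\<close>,
  \<open>s * H p + (\<Sum>i. ln \<Gamma>((\<alpha> - s) * p i)) - ln \<Gamma>(\<alpha> - s) + const\<close>,
  and its first two derivatives at \<open>0\<close> are the mean and the variance.
\<close>

declare One_nat_def [simp del]

section \<open>Divergence between measures on finitely many atoms\<close>

text \<open>Every singleton is measurable with counting mass 1, so evaluating both measures on
  singletons recovers the weights. This reduces the search for a Radon-Nikodym derivative to one
  equation per point.\<close>

lemma density_point_measure_UNIV_eq_iff:
  fixes f g h :: "'b \<Rightarrow> ennreal"
  shows "density (point_measure UNIV f) g = point_measure UNIV h \<longleftrightarrow> (\<forall>x. f x * g x = h x)"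
proof
  assume eq: "density (point_measure UNIV f) g = point_measure UNIV h"
  show "\<forall>x. f x * g x = h x"
  proof
    fix x
    have "f x * g x = emeasure (density (point_measure UNIV f) g) {x}"
      by (simp add: point_measure_def density_density_eq emeasure_density)
    also have "\<dots> = h x"
      unfolding eq by (simp add: point_measure_def emeasure_density)
    finally show "f x * g x = h x" .
  qed
next
  assume eq: "\<forall>x. f x * g x = h x"
  have "density (point_measure UNIV f) g = density (count_space UNIV) (\<lambda>x. f x * g x)"
    unfolding point_measure_def by (rule density_density_eq) simp_all
  with eq show "density (point_measure UNIV f) g = point_measure UNIV h"
    by (simp only: point_measure_def)
qed

text \<open>
  If some weight of \<open>w\<close> is not positive, absolute continuity fails, so \<open>RN_deriv\<close> takes its junk value
  \<open>0\<close> and, as \<open>ln 0 = 0\<close>, so does \<open>kl_atoms\<close>. Knowing the value there as well makes \<open>kl_atoms\<close> measurable.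
\<close>

lemma kl_atoms_eq:
  fixes \<xi> :: "nat \<Rightarrow> 'b" and p w :: "nat \<Rightarrow> real"
  assumes p: "\<And>i. i \<in> {1..n} \<Longrightarrow> 0 < p i" and inj: "inj_on \<xi> {1..n}"
  shows "kl_atoms n \<xi> p w =
    (if \<forall>i\<in>{1..n}. 0 < w i then \<Sum>i\<in>{1..n}. p i * ln (p i / w i) else 0)"
proof -
  \<comment> \<open>\<open>F c\<close> is the weight function of
    \<open>atomic_measure n \<xi> c\<close>. Injectivity of \<open>\<xi>\<close> keeps atoms from
    merging, so \<open>F c\<close> takes the value \<open>c i\<close> at
    \<open>\<xi> i\<close>.\<close>
  define F where "F c x = (\<Sum>i\<in>{1..n}. c i * indicator {\<xi> i} x)" for c :: "nat \<Rightarrow> real" and x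
  have F_atom: "F c (\<xi> i) = c i" if "i \<in> {1..n}" for c i
  proof -
    have "F c (\<xi> i) = (\<Sum>j\<in>{1..n}. if j = i then c j else 0)"
      unfolding F_def
    proof (intro sum.cong refl)
      fix j assume "j \<in> {1..n}"
      with that have "\<xi> i = \<xi> j \<longleftrightarrow> j = i" using inj by (metis inj_onD)
      then show "c j * indicator {\<xi> j} (\<xi> i) = (if j = i then c j else 0)" by simp
    qed
    with that show ?thesis by simp
  qed
  have F_off: "F c x = 0" if "x \<notin> \<xi> ` {1..n}" for c x
    using that unfolding F_def by (intro sum.neutral) (auto simp: indicator_def)
  have F_p: "0 \<le> F p x" for x
    unfolding F_def using p by (intro sum_nonneg mult_nonneg_nonneg) (auto simp: less_imp_le)
  define Mw where "Mw = atomic_measure n \<xi> w"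
  define Mp where "Mp = atomic_measure n \<xi> p"
  have Mw: "Mw = point_measure UNIV (\<lambda>x. ennreal (F w x))"
    and Mp: "Mp = point_measure UNIV (\<lambda>x. ennreal (F p x))"
    by (simp_all add: Mw_def Mp_def atomic_measure_def F_def)
  have dens: "density Mw g = Mp \<longleftrightarrow> (\<forall>x. ennreal (F w x) * g x = ennreal (F p x))" for g
    unfolding Mw Mp by (rule density_point_measure_UNIV_eq_iff)
  have meas: "g \<in> borel_measurable Mw" for g :: "'b \<Rightarrow> ennreal"
    by (simp add: Mw)
  let ?R = "\<lambda>x. ln (enn2real (RN_deriv Mw Mp x))"
  have "kl_atoms n \<xi> p w = (\<integral>x. ?R x \<partial>Mp)"
    unfolding kl_atoms_def KL_divergence_def entropy_density_def Mw_def[symmetric] Mp_def[symmetric]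
    by (simp add: comp_def log_def)
  also have "\<dots> = (\<integral>x. F p x * ?R x \<partial>count_space UNIV)"
    unfolding Mp point_measure_def using F_p by (subst integral_density) auto
  also have "\<dots> = (\<Sum>x | x \<in> UNIV \<and> F p x * ?R x \<noteq> 0. F p x * ?R x)"
  proof (rule lebesgue_integral_count_space_finite_support)
    have "{x \<in> UNIV. F p x * ?R x \<noteq> 0} \<subseteq> \<xi> ` {1..n}" using F_off by auto
    then show "finite {x \<in> UNIV. F p x * ?R x \<noteq> 0}" by (rule finite_subset) simp
  qed
  also have "\<dots> = (\<Sum>x\<in>\<xi> ` {1..n}. F p x * ?R x)"
    using F_off by (intro sum.mono_neutral_left) auto
  also have "\<dots> = (\<Sum>i\<in>{1..n}. p i * ?R (\<xi> i))"
    using inj by (subst sum.reindex) (auto intro!: sum.cong simp: F_atom)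
  also have "\<dots> = (if \<forall>i\<in>{1..n}. 0 < w i then \<Sum>i\<in>{1..n}. p i * ln (p i / w i) else 0)"
  proof (cases "\<forall>i\<in>{1..n}. 0 < w i")
    case True
    \<comment> \<open>The quotient of weights is a density: at an atom \<open>F w x\<close> cancels,
      and elsewhere both sides are 0. One such witness makes \<open>RN_deriv\<close> itself a
      density, with value forced at every atom.\<close>
    have "ennreal (F w x) * ennreal (F p x / F w x) = ennreal (F p x)" for x
    proof (cases "x \<in> \<xi> ` {1..n}")
      case x: True
      with True obtain i where "i \<in> {1..n}" "x = \<xi> i" "0 < w i" by auto
      with p[of i] show ?thesis by (simp add: F_atom flip: ennreal_mult)
    qed (simp add: F_off)
    then have "density Mw (RN_deriv Mw Mp) = Mp"
      by (intro RN_derivI[OF meas, of "\<lambda>x. ennreal (F p x / F w x)"]) (simp add: dens)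
    then have R: "ennreal (w i) * RN_deriv Mw Mp (\<xi> i) = ennreal (p i)" if "i \<in> {1..n}" for i
      using F_atom[OF that] unfolding dens by metis
    have "enn2real (RN_deriv Mw Mp (\<xi> i)) = p i / w i" if "i \<in> {1..n}" for i
    proof -
      from True that have "0 < w i" by auto
      moreover from arg_cong[OF R[OF that], of enn2real] have "w i * enn2real (RN_deriv Mw Mp (\<xi> i)) = p i"
        using p[OF that] \<open>0 < w i\<close> by (simp add: enn2real_mult)
      ultimately show ?thesis by (simp add: field_simps)
    qed
    with True show ?thesis by simp
  next
    case False
    then obtain i where i: "i \<in> {1..n}" "w i \<le> 0" by (auto simp: not_less)
    \<comment> \<open>\<open>ennreal\<close> truncates a negative weight to 0, so \<open>Mw\<close>
      gives the atom \<open>\<xi> i\<close> no mass while \<open>Mp\<close> gives it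
      \<open>p i\<close>, which is positive.\<close>
    have "density Mw g \<noteq> Mp" for g
    proof
      assume "density Mw g = Mp"
      then have "ennreal (w i) * g (\<xi> i) = ennreal (p i)"
        using F_atom[OF i(1)] unfolding dens by metis
      with i p[of i] show False by (simp add: ennreal_neg ennreal_eq_0_iff)
    qed
    then have "RN_deriv Mw Mp = (\<lambda>_. 0)" by (simp add: RN_deriv_def)
    with False show ?thesis by auto
  qed
  finally show ?thesis .
qed

section \<open>Dirichlet integrals over scaled simplices\<close>

text \<open>The substitution \<open>y = c * t\<close> reduces this to the Beta integral on the unit
  interval.\<close>

lemma nn_integral_scaled_Beta:
  fixes a b c :: real
  assumes a: "0 < a" and b: "0 < b" and c: "0 < c"
  shows "(\<integral>\<^sup>+ y. ennreal (indicator {0<..<c} y * (y powr (a - 1) * (c - y) powr (b - 1))) \<partial>lborel) =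
    ennreal (c powr (a + b - 1) * Beta a b)"
proof -
  let ?f = "\<lambda>y. ennreal (indicator {0<..<c} y * (y powr (a - 1) * (c - y) powr (b - 1)))"
  let ?h = "\<lambda>t. t powr (a - 1) * (1 - t) powr (b - 1)"
  have "(\<integral>\<^sup>+ y. ?f y \<partial>lborel) = ennreal c * (\<integral>\<^sup>+ t. ?f (c * t) \<partial>lborel)"
    using nn_integral_real_affine[of ?f c 0] c by simp
  also have "(\<integral>\<^sup>+ t. ?f (c * t) \<partial>lborel) =
      (\<integral>\<^sup>+ t. ennreal (c powr (a + b - 2)) * (ennreal (?h t) * indicator {0<..<1} t) \<partial>lborel)"
  proof (rule nn_integral_cong)
    fix t :: real
    show "?f (c * t) = ennreal (c powr (a + b - 2)) * (ennreal (?h t) * indicator {0<..<1} t)"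
    proof (cases "0 < t \<and> t < 1")
      case True
      have "(c - c * t) powr (b - 1) = c powr (b - 1) * (1 - t) powr (b - 1)"
        using True c by (simp flip: powr_mult add: algebra_simps)
      moreover have "c powr (a + b - 2) = c powr (a - 1) * c powr (b - 1)"
        by (simp flip: powr_add)
      ultimately show ?thesis using True c by (simp add: powr_mult flip: ennreal_mult)
    next
      case False
      then have "c * t \<notin> {0<..<c}" using c by (auto simp: zero_less_mult_iff)
      with False show ?thesis by auto
    qed
  qed
  also have "\<dots> = ennreal (c powr (a + b - 2)) * ennreal (Beta a b)"
    using has_integral_Beta_real[OF a b]
    by (subst nn_integral_cmult, measurable)
      (simp add: has_integral_Icc_iff_Ioo nn_integral_has_integral_lebesgue'[of "{0<..<1}" ?h])
  also have "ennreal c * \<dots> = ennreal (c powr (a + b - 1) * Beta a b)"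
  proof -
    \<comment> \<open>The additional factor \<open>c\<close> is the Jacobian of the
      substitution.\<close>
    have "c powr (a + b - 1) = c * c powr (a + b - 2)"
      using c powr_add[of c 1 "a + b - 2"] by simp
    moreover have "0 \<le> Beta a b"
      using a b by (simp add: Beta_def)
    ultimately show ?thesis using c by (simp flip: ennreal_mult add: mult.assoc)
  qed
  finally show ?thesis .
qed

text \<open>Induction on the index set: fixing one coordinate \<open>y\<close> leaves the same
  integral over a simplex of size \<open>c - y\<close>, which is why \<open>c\<close> is arbitrary.
  What remains is a scaled Beta integral in \<open>y\<close>. The parameter \<open>b\<close> belongs
  to the coordinate determined by the others.\<close>

lemma nn_integral_Dirichlet:
  fixes a :: "'i \<Rightarrow> real" and b c :: real
  assumes "finite I" and "\<And>i. i \<in> I \<Longrightarrow> 0 < a i" and "0 < b" and "0 < c"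
  shows "(\<integral>\<^sup>+ x. ennreal (if (\<forall>i\<in>I. 0 < x i) \<and> (\<Sum>i\<in>I. x i) < c
      then (\<Prod>i\<in>I. x i powr (a i - 1)) * (c - (\<Sum>i\<in>I. x i)) powr (b - 1) else 0)
      \<partial>Pi\<^sub>M I (\<lambda>_. lborel)) =
    ennreal (c powr ((\<Sum>i\<in>I. a i) + b - 1) * ((\<Prod>i\<in>I. Gamma (a i)) * Gamma b / Gamma ((\<Sum>i\<in>I. a i) + b)))"
  using assms
proof (induction I arbitrary: c rule: finite_induct)
  case empty
  \<comment> \<open>Over the empty index set the integral is \<open>c powr (b - 1)\<close>, and the
    quotient \<open>Gamma b / Gamma b\<close> has to cancel.\<close>
  from Gamma_real_pos[OF \<open>0 < b\<close>] have "Gamma b \<noteq> 0" by simp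
  with empty show ?case by (simp add: PiM_empty nn_integral_count_space_finite)
next
  case (insert i I)
  interpret product_sigma_finite "\<lambda>_. lborel :: real measure" by standard
  note [measurable] = \<open>finite I\<close>
  define A where "A = (\<Sum>i\<in>I. a i)"
  \<comment> \<open>By the induction hypothesis the inner integral is \<open>D\<close> times a power
    of the remaining size \<open>c - y\<close>.\<close>
  define D where "D = (\<Prod>i\<in>I. Gamma (a i)) * Gamma b / Gamma (A + b)"
  let ?g = "\<lambda>J c x. if (\<forall>i\<in>J. 0 < x i) \<and> (\<Sum>i\<in>J. x i) < c
      then (\<Prod>i\<in>J. x i powr (a i - 1)) * (c - (\<Sum>i\<in>J. x i)) powr (b - 1) else 0"
  have a: "0 < a i" and A: "0 \<le> A"
    using insert.prems(1) by (auto simp: A_def less_imp_le intro!: sum_nonneg)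
  have D: "0 \<le> D"
    unfolding D_def using insert.prems(1,2) A
    by (intro divide_nonneg_nonneg mult_nonneg_nonneg prod_nonneg) (auto intro!: less_imp_le)
  have "(\<integral>\<^sup>+ x. ennreal (?g (insert i I) c x) \<partial>Pi\<^sub>M (insert i I) (\<lambda>_. lborel)) =
      (\<integral>\<^sup>+ y. (\<integral>\<^sup>+ x. ennreal (?g (insert i I) c (x(i := y))) \<partial>Pi\<^sub>M I (\<lambda>_. lborel)) \<partial>lborel)"
    using insert.hyps by (intro product_nn_integral_insert_rev) measurable
  also have "\<dots> = (\<integral>\<^sup>+ y. ennreal D *
      ennreal (indicator {0<..<c} y * (y powr (a i - 1) * (c - y) powr (A + b - 1))) \<partial>lborel)"
  proof (rule nn_integral_cong)
    fix y :: real
    have upd: "(\<Sum>j\<in>insert i I. (x(i := y)) j) = y + (\<Sum>j\<in>I. x j)"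
      "(\<Prod>j\<in>insert i I. (x(i := y)) j powr (a j - 1)) = y powr (a i - 1) * (\<Prod>j\<in>I. x j powr (a j - 1))"
      "(\<forall>j\<in>insert i I. 0 < (x(i := y)) j) \<longleftrightarrow> 0 < y \<and> (\<forall>j\<in>I. 0 < x j)" for x
      using insert.hyps by (auto intro!: sum.cong prod.cong)
    have g: "?g (insert i I) c (x(i := y)) = (if 0 < y then y powr (a i - 1) * ?g I (c - y) x else 0)" for x
      unfolding upd by (auto simp: algebra_simps)
    show "(\<integral>\<^sup>+ x. ennreal (?g (insert i I) c (x(i := y))) \<partial>Pi\<^sub>M I (\<lambda>_. lborel)) = ennreal D *
      ennreal (indicator {0<..<c} y * (y powr (a i - 1) * (c - y) powr (A + b - 1)))"
    proof (cases "0 < y \<and> y < c")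
      case True
      have "(\<integral>\<^sup>+ x. ennreal (?g (insert i I) c (x(i := y))) \<partial>Pi\<^sub>M I (\<lambda>_. lborel)) =
        (\<integral>\<^sup>+ x. ennreal (y powr (a i - 1)) * ennreal (?g I (c - y) x) \<partial>Pi\<^sub>M I (\<lambda>_. lborel))"
        unfolding g using True by (intro nn_integral_cong) (simp add: ennreal_mult')
      also have "\<dots> = ennreal (y powr (a i - 1)) * (\<integral>\<^sup>+ x. ennreal (?g I (c - y) x) \<partial>Pi\<^sub>M I (\<lambda>_. lborel))"
        by (rule nn_integral_cmult) measurable
      also have "(\<integral>\<^sup>+ x. ennreal (?g I (c - y) x) \<partial>Pi\<^sub>M I (\<lambda>_. lborel)) =
          ennreal ((c - y) powr (A + b - 1) * D)"
        unfolding A_def D_def using True insert.prems by (intro insert.IH) auto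
      finally show ?thesis using True D by (simp add: ac_simps flip: ennreal_mult)
    next
      case False
      \<comment> \<open>For \<open>y \<ge> c\<close> positive remaining coordinates have a
        nonnegative sum, which cannot stay below \<open>c - y\<close>.\<close>
      have g_0: "?g (insert i I) c (x(i := y)) = 0" for x
      proof (cases "\<forall>j\<in>I. 0 < x j")
        case True
        then have "0 \<le> (\<Sum>j\<in>I. x j)" by (intro sum_nonneg) (auto intro: less_imp_le)
        with False show ?thesis unfolding g by auto
      next
        case False
        then show ?thesis unfolding g by auto
      qed
      show ?thesis unfolding g_0 using False by auto
    qed
  qed
  also have "\<dots> = ennreal D * ennreal (c powr (a i + (A + b) - 1) * Beta (a i) (A + b))"
    using nn_integral_scaled_Beta[of "a i" "A + b" c] a A insert.prems
    by (subst nn_integral_cmult) auto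
  also have "\<dots> = ennreal (c powr ((\<Sum>i\<in>insert i I. a i) + b - 1) *
      ((\<Prod>i\<in>insert i I. Gamma (a i)) * Gamma b / Gamma ((\<Sum>i\<in>insert i I. a i) + b)))"
  proof -
    \<comment> \<open>This factor is the denominator of \<open>D\<close> and occurs in the numerator
      of \<open>Beta (a i) (A + b)\<close>, where it cancels.\<close>
    have "Gamma (A + b) > 0" using A insert.prems by simp
    moreover have "(\<Sum>i\<in>insert i I. a i) + b = a i + (A + b)"
      using insert.hyps by (simp add: A_def)
    ultimately show ?thesis
      using D insert.hyps unfolding D_def[symmetric]
      by (simp add: ennreal_mult'[symmetric] D_def Beta_def field_simps)
  qed
  finally show ?case .
qed

section \<open>Total mass and moments of the Dirichlet distribution\<close>

lemma simplex_point_measurable [measurable]: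
  "simplex_point n \<in> measurable (Pi\<^sub>M {1..<n} (\<lambda>_. lborel)) (Pi\<^sub>M {1..n} (\<lambda>_. borel))"
  unfolding simplex_point_def
proof (rule measurable_restrict)
  fix i assume "i \<in> {1..n}"
  then show "(\<lambda>x. if i = n then 1 - (\<Sum>j\<in>{1..<n}. x j) else x i)
      \<in> borel_measurable (Pi\<^sub>M {1..<n} (\<lambda>_. lborel))"
    by (cases "i = n") (auto intro!: borel_measurable_diff borel_measurable_sum)
qed

lemma dirichlet_density_measurable [measurable]:
  "dirichlet_density n a \<in> borel_measurable (Pi\<^sub>M {1..n} (\<lambda>_. borel))"
  unfolding dirichlet_density_def by measurable

text \<open>Splitting off the dependent coordinate \<open>n\<close> turns the density into the
  integrand of \<open>nn_integral_Dirichlet\<close> on \<open>{1..<n}\<close> with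
  \<open>b = a n\<close> and \<open>c = 1\<close>, whose value is the reciprocal of the normalising
  constant.\<close>

lemma nn_integral_dirichlet_density:
  fixes a :: "nat \<Rightarrow> real"
  assumes n: "1 \<le> n" and a: "\<And>i. i \<in> {1..n} \<Longrightarrow> 0 < a i"
  shows "(\<integral>\<^sup>+ x. ennreal (dirichlet_density n a (simplex_point n x)) \<partial>Pi\<^sub>M {1..<n} (\<lambda>_. lborel)) = 1"
proof -
  have split: "{1..n} = insert n {1..<n}" using n by auto
  define C where "C = Gamma (\<Sum>i\<in>{1..n}. a i) / (\<Prod>i\<in>{1..n}. Gamma (a i))"
  have pos: "0 < Gamma (\<Sum>i\<in>{1..n}. a i)" "0 < (\<Prod>i\<in>{1..n}. Gamma (a i))"
    using a n by (auto intro!: sum_pos prod_pos)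
  let ?g = "\<lambda>x. if (\<forall>i\<in>{1..<n}. 0 < x i) \<and> (\<Sum>i\<in>{1..<n}. x i) < 1
      then (\<Prod>i\<in>{1..<n}. x i powr (a i - 1)) * (1 - (\<Sum>i\<in>{1..<n}. x i)) powr (a n - 1) else 0"
  have "dirichlet_density n a (simplex_point n x) = C * ?g x" for x
  proof -
    have last: "simplex_point n x n = 1 - (\<Sum>i\<in>{1..<n}. x i)"
      using n by (simp add: simplex_point_def)
    have rest: "simplex_point n x i = x i" if "i \<in> {1..<n}" for i
      using that by (simp add: simplex_point_def)
    have "(\<forall>i\<in>{1..n}. 0 < simplex_point n x i) \<longleftrightarrow>
        (\<forall>i\<in>{1..<n}. 0 < x i) \<and> (\<Sum>i\<in>{1..<n}. x i) < 1"
      unfolding split using last rest by auto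
    moreover have "(\<Prod>i\<in>{1..n}. simplex_point n x i powr (a i - 1)) =
        (\<Prod>i\<in>{1..<n}. x i powr (a i - 1)) * (1 - (\<Sum>i\<in>{1..<n}. x i)) powr (a n - 1)"
      unfolding split using last rest by (simp add: mult.commute)
    ultimately show ?thesis
      unfolding dirichlet_density_def C_def by simp
  qed
  moreover have "0 \<le> C"
    using pos by (simp add: C_def)
  ultimately have "(\<integral>\<^sup>+ x. ennreal (dirichlet_density n a (simplex_point n x)) \<partial>Pi\<^sub>M {1..<n} (\<lambda>_. lborel)) =
      (\<integral>\<^sup>+ x. ennreal C * ennreal (?g x) \<partial>Pi\<^sub>M {1..<n} (\<lambda>_. lborel))"
    by (simp only: ennreal_mult')
  also have "\<dots> = ennreal C * (\<integral>\<^sup>+ x. ennreal (?g x) \<partial>Pi\<^sub>M {1..<n} (\<lambda>_. lborel))"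
    by (rule nn_integral_cmult) measurable
  also have "(\<integral>\<^sup>+ x. ennreal (?g x) \<partial>Pi\<^sub>M {1..<n} (\<lambda>_. lborel)) = ennreal (1 / C)"
    using a n by (subst nn_integral_Dirichlet) (auto simp: C_def split add.commute mult.commute)
  also have "ennreal C * \<dots> = 1"
    using pos by (simp add: C_def del: prod_zero_iff flip: ennreal_mult)
  finally show ?thesis .
qed

lemma nn_integral_dirichlet:
  assumes "f \<in> borel_measurable (Pi\<^sub>M {1..n} (\<lambda>_. borel))"
  shows "(\<integral>\<^sup>+ w. f w \<partial>dirichlet n a) = (\<integral>\<^sup>+ x. ennreal (dirichlet_density n a (simplex_point n x)) *
    f (simplex_point n x) \<partial>Pi\<^sub>M {1..<n} (\<lambda>_. lborel))"
  using assms unfolding dirichlet_def by (simp add: nn_integral_distr nn_integral_density)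

text \<open>The density vanishes wherever some coordinate is not positive. Hence the default value
  of \<open>kl_atoms\<close> occurs with probability 0.\<close>

lemma AE_dirichlet_pos: "AE w in dirichlet n a. \<forall>i\<in>{1..n}. 0 < w i"
  unfolding dirichlet_def
proof (subst AE_distr_iff)
  show "AE x in density (Pi\<^sub>M {1..<n} (\<lambda>_. lborel))
      (\<lambda>x. ennreal (dirichlet_density n a (simplex_point n x))). \<forall>i\<in>{1..n}. 0 < simplex_point n x i"
    by (subst AE_density) (auto simp: dirichlet_density_def)
qed simp_all

text \<open>The monomial shifts the exponents, so the density becomes a multiple of the one with
  parameters \<open>a i + t i\<close>. That one has mass 1, which leaves the ratio of the two
  normalising constants. The \<open>t i\<close> may be negative.\<close>

lemma dirichlet_moment:
  fixes a t :: "nat \<Rightarrow> real"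
  assumes n: "1 \<le> n" and a: "\<And>i. i \<in> {1..n} \<Longrightarrow> 0 < a i"
    and at: "\<And>i. i \<in> {1..n} \<Longrightarrow> 0 < a i + t i"
  shows "(\<integral>\<^sup>+ w. ennreal (\<Prod>i\<in>{1..n}. w i powr t i) \<partial>dirichlet n a) =
    ennreal (Gamma (\<Sum>i\<in>{1..n}. a i) / (\<Prod>i\<in>{1..n}. Gamma (a i)) *
      ((\<Prod>i\<in>{1..n}. Gamma (a i + t i)) / Gamma (\<Sum>i\<in>{1..n}. a i + t i)))"
proof -
  define C where "C = Gamma (\<Sum>i\<in>{1..n}. a i) / (\<Prod>i\<in>{1..n}. Gamma (a i)) *
      ((\<Prod>i\<in>{1..n}. Gamma (a i + t i)) / Gamma (\<Sum>i\<in>{1..n}. a i + t i))"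
  have pos: "0 < Gamma (\<Sum>i\<in>{1..n}. a i + t i)" "0 < (\<Prod>i\<in>{1..n}. Gamma (a i + t i))"
    "0 < Gamma (\<Sum>i\<in>{1..n}. a i)" "0 < (\<Prod>i\<in>{1..n}. Gamma (a i))"
    using a at n by (auto intro!: sum_pos prod_pos Gamma_real_pos)
  have "dirichlet_density n a x * (\<Prod>i\<in>{1..n}. x i powr t i) =
      C * dirichlet_density n (\<lambda>i. a i + t i) x" for x
  proof (cases "\<forall>i\<in>{1..n}. 0 < x i")
    case True
    have "(\<Prod>i\<in>{1..n}. x i powr (a i - 1)) * (\<Prod>i\<in>{1..n}. x i powr t i) =
        (\<Prod>i\<in>{1..n}. x i powr (a i + t i - 1))"
      unfolding prod.distrib[symmetric] powr_add[symmetric] by (simp add: algebra_simps)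
    then show ?thesis using True pos unfolding dirichlet_density_def C_def by (simp del: prod_zero_iff)
  qed (auto simp: dirichlet_density_def)
  moreover have "0 \<le> C"
    using pos by (simp add: C_def)
  moreover have "0 \<le> dirichlet_density n a x" for x
    using pos by (auto simp: dirichlet_density_def intro!: divide_nonneg_pos mult_nonneg_nonneg prod_nonneg)
  ultimately have "(\<integral>\<^sup>+ w. ennreal (\<Prod>i\<in>{1..n}. w i powr t i) \<partial>dirichlet n a) =
      (\<integral>\<^sup>+ x. ennreal C * ennreal (dirichlet_density n (\<lambda>i. a i + t i) (simplex_point n x))
        \<partial>Pi\<^sub>M {1..<n} (\<lambda>_. lborel))"
    by (subst nn_integral_dirichlet) (simp_all flip: ennreal_mult')
  also have "\<dots> = ennreal C"
    using nn_integral_dirichlet_density[of n "\<lambda>i. a i + t i"] n at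
    by (subst nn_integral_cmult) auto
  finally show ?thesis unfolding C_def .
qed

section \<open>Moments and cumulants from the moment generating function\<close>

text \<open>A single term of the exponential series bounds
  \<open>(r * \<bar>X x\<bar>) ^ k / fact k\<close> by \<open>exp (r * \<bar>X x\<bar>)\<close>, and
  this is at most the sum of the two integrable exponentials.\<close>

lemma integrable_power_of_mgf:
  fixes X :: "'a \<Rightarrow> real"
  assumes X[measurable]: "X \<in> borel_measurable M" and "0 < r"
    and int: "integrable M (\<lambda>x. exp (r * X x))" "integrable M (\<lambda>x. exp (- r * X x))"
  shows "integrable M (\<lambda>x. X x ^ k)"
proof (rule Bochner_Integration.integrable_bound)
  show "integrable M (\<lambda>x. fact k / r ^ k * (exp (r * X x) + exp (- r * X x)))"
    using int by auto
  have "\<bar>X x\<bar> ^ k \<le> fact k / r ^ k * (exp (r * X x) + exp (- r * X x))" for x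
  proof -
    have "(r * \<bar>X x\<bar>) ^ k / fact k \<le> exp (r * \<bar>X x\<bar>)"
      using sum_le_suminf[OF summable_exp, of "{k}" "r * \<bar>X x\<bar>"] \<open>0 < r\<close>
      by (simp add: exp_def field_simps)
    also have "\<dots> \<le> exp (r * X x) + exp (- r * X x)"
      by (cases "0 \<le> X x") (auto simp: abs_if)
    finally show ?thesis using \<open>0 < r\<close> by (simp add: field_simps power_mult_distrib)
  qed
  then show "AE x in M. norm (X x ^ k) \<le> norm (fact k / r ^ k * (exp (r * X x) + exp (- r * X x)))"
    using \<open>0 < r\<close> by (intro AE_I2) (simp add: power_abs abs_mult)
qed simp

text \<open>The exponential series may be integrated term by term, because the partial sums of the
  absolute values stay below \<open>exp \<bar>s * X x\<bar>\<close>, which is integrable.\<close>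

lemma mgf_sums:
  fixes X :: "'a \<Rightarrow> real"
  assumes X[measurable]: "X \<in> borel_measurable M"
    and int: "\<And>s. \<bar>s\<bar> < \<delta> \<Longrightarrow> integrable M (\<lambda>x. exp (s * X x))" and s: "\<bar>s\<bar> < \<delta>"
  shows "(\<lambda>k. (\<integral>x. X x ^ k \<partial>M) / fact k * s ^ k) sums (\<integral>x. exp (s * X x) \<partial>M)"
proof -
  define f where "f k x = (s * X x) ^ k / fact k" for k x
  \<comment> \<open>The midpoint of \<open>\<bar>s\<bar>\<close> and \<open>\<delta>\<close> is
    below \<open>\<delta>\<close> and positive even for \<open>s = 0\<close>.\<close>
  have pow: "integrable M (\<lambda>x. X x ^ k)" for k
    using s int[of "(\<bar>s\<bar> + \<delta>) / 2"] int[of "- ((\<bar>s\<bar> + \<delta>) / 2)"]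
    by (intro integrable_power_of_mgf[of X M "(\<bar>s\<bar> + \<delta>) / 2"]) auto
  have f_int: "integrable M (f k)" for k
    unfolding f_def using pow[of k] by (simp add: power_mult_distrib)
  have f_sums: "(\<lambda>k. f k x) sums exp (s * X x)" for x
    using exp_converges[of "s * X x"] by (simp add: f_def field_simps)
  have nf_sums: "(\<lambda>k. norm (f k x)) sums exp \<bar>s * X x\<bar>" for x
    using exp_converges[of "\<bar>s * X x\<bar>"] by (simp add: f_def power_abs abs_mult field_simps)
  \<comment> \<open>The range of admissible \<open>s\<close> is symmetric, so \<open>- s\<close> is
    available for the domination too.\<close>
  have dom: "integrable M (\<lambda>x. exp \<bar>s * X x\<bar>)"
  proof (rule Bochner_Integration.integrable_bound)
    show "integrable M (\<lambda>x. exp (s * X x) + exp (- s * X x))"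
      using int[of s] int[of "- s"] s by auto
    show "AE x in M. norm (exp \<bar>s * X x\<bar>) \<le> norm (exp (s * X x) + exp (- s * X x))"
      by (intro AE_I2) (auto simp: abs_if[of "s * X _"] abs_of_pos add_pos_pos)
  qed simp
  have "summable (\<lambda>k. \<integral>x. norm (f k x) \<partial>M)"
  proof (rule summableI_nonneg_bounded)
    fix n
    have "(\<Sum>k<n. \<integral>x. norm (f k x) \<partial>M) = (\<integral>x. (\<Sum>k<n. norm (f k x)) \<partial>M)"
      using f_int by (subst Bochner_Integration.integral_sum) auto
    also have "\<dots> \<le> (\<integral>x. exp \<bar>s * X x\<bar> \<partial>M)"
    proof (intro integral_mono dom)
      show "integrable M (\<lambda>x. \<Sum>k<n. norm (f k x))" using f_int by auto
      show "(\<Sum>k<n. norm (f k x)) \<le> exp \<bar>s * X x\<bar>" for x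
        using sum_le_suminf[OF sums_summable[OF nf_sums], of "{..<n}" x] sums_unique[OF nf_sums, of x]
        by simp
    qed
    finally show "(\<Sum>k<n. \<integral>x. norm (f k x) \<partial>M) \<le> (\<integral>x. exp \<bar>s * X x\<bar> \<partial>M)" .
  qed simp
  then have "(\<lambda>k. integral\<^sup>L M (f k)) sums (\<integral>x. (\<Sum>k. f k x) \<partial>M)"
    by (intro sums_integral f_int AE_I2 sums_summable[OF nf_sums])
  moreover have "integral\<^sup>L M (f k) = (\<integral>x. X x ^ k \<partial>M) / fact k * s ^ k" for k
    unfolding f_def by (simp add: power_mult_distrib)
  ultimately show ?thesis
    using sums_unique[OF f_sums] by simp
qed

text \<open>Near 0 the power series of the moments and \<open>exp (K s)\<close> are the same
  function. Differentiating both twice and comparing at 0 expresses the first two moments through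
  the derivatives of \<open>K\<close>.\<close>

lemma (in prob_space) moments_from_cgf:
  fixes X :: "'a \<Rightarrow> real" and K K1 :: "real \<Rightarrow> real"
  assumes X[measurable]: "X \<in> borel_measurable M" and \<delta>: "0 < \<delta>"
    and int: "\<And>s. \<bar>s\<bar> < \<delta> \<Longrightarrow> integrable M (\<lambda>x. exp (s * X x))"
    and cgf: "\<And>s. \<bar>s\<bar> < \<delta> \<Longrightarrow> expectation (\<lambda>x. exp (s * X x)) = exp (K s)"
    and K: "\<And>s. \<bar>s\<bar> < \<delta> \<Longrightarrow> (K has_field_derivative K1 s) (at s)"
    and K1: "(K1 has_field_derivative K2) (at 0)"
  shows "integrable M X" and "integrable M (\<lambda>x. (X x)\<^sup>2)"
    and "expectation X = K1 0" and "variance X = K2"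
proof -
  have pow: "integrable M (\<lambda>x. X x ^ k)" for k
    using \<delta> int[of "\<delta> / 2"] int[of "- (\<delta> / 2)"]
    by (intro integrable_power_of_mgf[of X M "\<delta> / 2"]) auto
  show int1: "integrable M X" and int2: "integrable M (\<lambda>x. (X x)\<^sup>2)"
    using pow[of 1] pow[of 2] by auto
  define c where "c k = expectation (\<lambda>x. X x ^ k) / fact k" for k
  have sums: "(\<lambda>k. c k * s ^ k) sums exp (K s)" if "\<bar>s\<bar> < \<delta>" for s
    using mgf_sums[OF X int that] cgf[OF that] by (simp add: c_def)
  have summable: "summable (\<lambda>k. c k * s ^ k)" if "norm s < \<delta>" for s
    using sums[of s] that by (auto simp: sums_iff)
  have zero: "\<bar>0\<bar> < \<delta>"
    using \<delta> by simp
  have near: "\<forall>\<^sub>F s in nhds s0. \<bar>s\<bar> < \<delta>" if "\<bar>s0\<bar> < \<delta>" for s0 :: real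
    using eventually_nhds_in_open[of "ball 0 \<delta>" s0] that by simp
  \<comment> \<open>The first derivatives are compared on the whole interval, since the identity is
    differentiated once more in \<open>D2\<close>.\<close>
  have D1: "(\<Sum>k. diffs c k * s ^ k) = exp (K s) * K1 s" if s: "\<bar>s\<bar> < \<delta>" for s
  proof (rule DERIV_unique)
    show "((\<lambda>s. \<Sum>k. c k * s ^ k) has_field_derivative (\<Sum>k. diffs c k * s ^ k)) (at s)"
      using s by (intro termdiffs_strong'[of \<delta>] summable) simp_all
    have "((\<lambda>s. exp (K s)) has_field_derivative exp (K s) * K1 s) (at s)"
      using K[OF s] by (rule DERIV_exp[THEN DERIV_chain2])
    moreover have "\<forall>\<^sub>F s in nhds s. (\<Sum>k. c k * s ^ k) = exp (K s)"
      using near[OF s] by eventually_elim (rule sums_unique[OF sums, symmetric])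
    ultimately show "((\<lambda>s. \<Sum>k. c k * s ^ k) has_field_derivative exp (K s) * K1 s) (at s)"
      by (rule DERIV_cong_ev[OF refl _ refl, THEN iffD2, rotated])
  qed
  have D2: "(\<Sum>k. diffs (diffs c) k * 0 ^ k) = exp (K 0) * K2 + exp (K 0) * K1 0 * K1 0"
  proof (rule DERIV_unique)
    have "summable (\<lambda>k. diffs c k * s ^ k)" if "norm s < \<delta>" for s
      using that by (rule termdiff_converges) (rule summable)
    then show "((\<lambda>s. \<Sum>k. diffs c k * s ^ k) has_field_derivative (\<Sum>k. diffs (diffs c) k * 0 ^ k)) (at 0)"
      using \<delta> by (intro termdiffs_strong'[of \<delta>]) auto
    have "((\<lambda>s. exp (K s) * K1 s) has_field_derivative exp (K 0) * K2 + exp (K 0) * K1 0 * K1 0) (at 0)"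
      using K[of 0] K1 \<delta> by (auto intro!: derivative_eq_intros)
    moreover have "\<forall>\<^sub>F s in nhds 0. (\<Sum>k. diffs c k * s ^ k) = exp (K s) * K1 s"
      using near[OF zero] by eventually_elim (rule D1)
    ultimately show "((\<lambda>s. \<Sum>k. diffs c k * s ^ k) has_field_derivative
        exp (K 0) * K2 + exp (K 0) * K1 0 * K1 0) (at 0)"
      by (rule DERIV_cong_ev[OF refl _ refl, THEN iffD2, rotated])
  qed
  \<comment> \<open>At \<open>s = 0\<close> the moment generating function is the total
    mass.\<close>
  have K0: "exp (K 0) = 1"
    using cgf[of 0] \<delta> by (simp add: prob_space)
  show mean: "expectation X = K1 0"
    using D1[OF zero] K0 unfolding powser_zero by (simp add: diffs_def c_def)
  \<comment> \<open>The constant term of the twice differentiated series is \<open>2 * c 2\<close>,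
    and the 2 cancels \<open>fact 2\<close>.\<close>
  have "expectation (\<lambda>x. (X x)\<^sup>2) = K2 + (K1 0)\<^sup>2"
    using D2 K0 unfolding powser_zero by (simp add: diffs_def c_def power2_eq_square)
  then show "variance X = K2"
    using mean by (subst variance_eq[OF int1 int2]) simp
qed

section \<open>Mean and variance of the divergence\<close>

theorem proposition5:
  fixes n :: nat
    and p :: "nat \<Rightarrow> real"
    and \<alpha> :: real
    and \<xi> :: "nat \<Rightarrow> 'b"
    and M :: "'a measure"
    and w :: "'a \<Rightarrow> nat \<Rightarrow> real"
  assumes "n \<ge> 1"
    and "\<And>i. i \<in> {1..n} \<Longrightarrow> 0 < p i"
    and "(\<Sum>i\<in>{1..n}. p i) = 1"
    and "0 < \<alpha>"
    and "inj_on \<xi> {1..n}"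
    and "prob_space M"
    and "w \<in> measurable M (Pi\<^sub>M {1..n} (\<lambda>_. borel))"
    and "distr M (Pi\<^sub>M {1..n} (\<lambda>_. borel)) w = dirichlet n (\<lambda>i. \<alpha> * p i)"
  shows "(AE \<omega> in M. kl_atoms n \<xi> p (w \<omega>) = (\<Sum>i\<in>{1..n}. p i * ln (p i / w \<omega> i))) \<and>
    integrable M (\<lambda>\<omega>. kl_atoms n \<xi> p (w \<omega>)) \<and>
    prob_space.expectation M (\<lambda>\<omega>. kl_atoms n \<xi> p (w \<omega>)) =
      H n p - (\<Sum>i\<in>{1..n}. p i * (Digamma (\<alpha> * p i) - Digamma \<alpha>)) \<and>
    integrable M (\<lambda>\<omega>. (kl_atoms n \<xi> p (w \<omega>))\<^sup>2) \<and>
    prob_space.variance M (\<lambda>\<omega>. kl_atoms n \<xi> p (w \<omega>)) =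
      (\<Sum>i\<in>{1..n}. (p i)\<^sup>2 * Polygamma 1 (\<alpha> * p i)) - Polygamma 1 \<alpha>"
proof -
  note n = assms(1) and p = assms(2) and sum_p = assms(3) and \<alpha> = assms(4) and inj = assms(5)
    and w [measurable] = assms(7) and w_distr = assms(8)
  interpret prob_space M by (rule assms(6))
  define X where "X \<omega> = kl_atoms n \<xi> p (w \<omega>)" for \<omega>
  have kl_eq: "kl_atoms n \<xi> p v =
      (if \<forall>i\<in>{1..n}. 0 < v i then \<Sum>i\<in>{1..n}. p i * ln (p i / v i) else 0)" for v
    by (rule kl_atoms_eq[OF _ inj]) (rule p)
  have "kl_atoms n \<xi> p \<in> borel_measurable (Pi\<^sub>M {1..n} (\<lambda>_. borel))"
    by (subst measurable_cong[OF kl_eq]) measurable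
  then have X [measurable]: "X \<in> borel_measurable M"
    unfolding X_def by measurable
  have pos: "AE \<omega> in M. \<forall>i\<in>{1..n}. 0 < w \<omega> i"
    using AE_dirichlet_pos[of n "\<lambda>i. \<alpha> * p i"] unfolding w_distr[symmetric]
    by (rule AE_distrD[OF w])
  then have X_AE: "AE \<omega> in M. X \<omega> = (\<Sum>i\<in>{1..n}. p i * ln (p i / w \<omega> i))"
    by eventually_elim (simp add: X_def kl_eq)

  \<comment> \<open>The terms free of \<open>s\<close> are the logarithm of the normalising constant
    of the Dirichlet density, whose parameters sum to \<open>\<alpha>\<close>. They make
    \<open>K 0 = 0\<close>.\<close>
  define K where "K s = s * H n p + ln_Gamma \<alpha> - (\<Sum>i\<in>{1..n}. ln_Gamma (\<alpha> * p i)) +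
      (\<Sum>i\<in>{1..n}. ln_Gamma ((\<alpha> - s) * p i)) - ln_Gamma (\<alpha> - s)" for s
  define K1 where "K1 s = H n p - (\<Sum>i\<in>{1..n}. p i * Digamma ((\<alpha> - s) * p i)) + Digamma (\<alpha> - s)" for s
  define K2 where "K2 = (\<Sum>i\<in>{1..n}. (p i)\<^sup>2 * Polygamma 1 (\<alpha> * p i)) - Polygamma 1 \<alpha>"

  have mgf: "integrable M (\<lambda>\<omega>. exp (s * X \<omega>)) \<and> expectation (\<lambda>\<omega>. exp (s * X \<omega>)) = exp (K s)"
    if s: "\<bar>s\<bar> < \<alpha>" for s
  proof -
    \<comment> \<open>These exponents change the parameters into
      \<open>(\<alpha> - s) * p i\<close>, which stay positive because
      \<open>s < \<alpha>\<close>.\<close>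
    let ?t = "\<lambda>i. - (s * p i)"
    have shift: "\<alpha> * p i + ?t i = (\<alpha> - s) * p i" for i
      by (simp add: algebra_simps)
    have shift_pos: "0 < (\<alpha> - s) * p i" if "i \<in> {1..n}" for i
      using s p[OF that] by simp
    have exp_X: "exp (s * (\<Sum>i\<in>{1..n}. p i * ln (p i / v i))) = exp (s * H n p) * (\<Prod>i\<in>{1..n}. v i powr ?t i)"
      if v: "\<forall>i\<in>{1..n}. 0 < v i" for v
    proof -
      have "s * (\<Sum>i\<in>{1..n}. p i * ln (p i / v i)) = s * H n p + (\<Sum>i\<in>{1..n}. ?t i * ln (v i))"
        unfolding H_def sum_distrib_left sum.distrib[symmetric]
      proof (rule sum.cong[OF refl])
        fix i assume "i \<in> {1..n}"
        then have "0 < p i" "0 < v i"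
          using p v by auto
        then show "s * (p i * ln (p i / v i)) = s * (p i * ln (p i)) + ?t i * ln (v i)"
          by (simp add: ln_div algebra_simps)
      qed
      also have "exp \<dots> = exp (s * H n p) * (\<Prod>i\<in>{1..n}. exp (?t i * ln (v i)))"
        by (simp add: exp_add exp_sum)
      also have "(\<Prod>i\<in>{1..n}. exp (?t i * ln (v i))) = (\<Prod>i\<in>{1..n}. v i powr ?t i)"
        using v by (intro prod.cong refl) (fastforce simp: powr_def)
      finally show ?thesis .
    qed
    have "(\<integral>\<^sup>+ \<omega>. ennreal (exp (s * X \<omega>)) \<partial>M) =
        (\<integral>\<^sup>+ \<omega>. ennreal (exp (s * H n p)) * ennreal (\<Prod>i\<in>{1..n}. w \<omega> i powr ?t i) \<partial>M)"
    proof (rule nn_integral_cong_AE)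
      show "AE \<omega> in M. ennreal (exp (s * X \<omega>)) =
          ennreal (exp (s * H n p)) * ennreal (\<Prod>i\<in>{1..n}. w \<omega> i powr ?t i)"
        using pos X_AE
      proof eventually_elim
        case (elim \<omega>)
        then show ?case by (simp only: exp_X ennreal_mult' exp_ge_zero)
      qed
    qed
    also have "\<dots> = (\<integral>\<^sup>+ v. ennreal (exp (s * H n p)) * ennreal (\<Prod>i\<in>{1..n}. v i powr ?t i)
        \<partial>dirichlet n (\<lambda>i. \<alpha> * p i))"
      unfolding w_distr[symmetric] by (rule nn_integral_distr[symmetric]) measurable
    also have "\<dots> = ennreal (exp (s * H n p)) *
        (\<integral>\<^sup>+ v. ennreal (\<Prod>i\<in>{1..n}. v i powr ?t i) \<partial>dirichlet n (\<lambda>i. \<alpha> * p i))"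
      unfolding w_distr[symmetric] by (rule nn_integral_cmult) measurable
    also have "(\<integral>\<^sup>+ v. ennreal (\<Prod>i\<in>{1..n}. v i powr ?t i) \<partial>dirichlet n (\<lambda>i. \<alpha> * p i)) =
        ennreal (Gamma (\<Sum>i\<in>{1..n}. \<alpha> * p i) / (\<Prod>i\<in>{1..n}. Gamma (\<alpha> * p i)) *
          ((\<Prod>i\<in>{1..n}. Gamma ((\<alpha> - s) * p i)) / Gamma (\<Sum>i\<in>{1..n}. (\<alpha> - s) * p i)))"
      using dirichlet_moment[OF n, of "\<lambda>i. \<alpha> * p i" ?t] \<alpha> p shift_pos unfolding shift by simp
    also have "ennreal (exp (s * H n p)) * \<dots> = ennreal (exp (K s))"
    proof -
      \<comment> \<open>As the \<open>p i\<close> sum to 1, the Gamma factors of the parameter sums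
        are \<open>Gamma \<alpha>\<close> and \<open>Gamma (\<alpha> - s)\<close>.\<close>
      have "(\<Sum>i\<in>{1..n}. c * p i) = c" for c
        by (simp add: sum_p flip: sum_distrib_left)
      moreover have "(\<Prod>i\<in>{1..n}. Gamma (c * p i)) = exp (\<Sum>i\<in>{1..n}. ln_Gamma (c * p i))"
        if "0 < c" for c
        using that p by (simp add: exp_sum Gamma_real_pos_exp)
      ultimately show ?thesis
        using \<alpha> s by (simp add: K_def exp_add exp_diff Gamma_real_pos_exp flip: ennreal_mult)
    qed
    \<comment> \<open>For a nonnegative function, a finite value of the nonnegative integral gives
      integrability and the expectation together.\<close>
    finally show ?thesis
      by (subst (asm) nn_integral_eq_integrable) auto
  qed
  have K_deriv: "(K has_field_derivative K1 s) (at s)" if s: "\<bar>s\<bar> < \<alpha>" for s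
  proof -
    have "s < \<alpha>"
      using s by simp
    then show ?thesis
      unfolding K_def K1_def using p
      by (auto intro!: derivative_eq_intros sum.cong simp: sum_negf mult.commute zero_less_mult_iff)
  qed
  have K1_deriv: "(K1 has_field_derivative K2) (at 0)"
  proof -
    \<comment> \<open>Taken at \<open>c = p i\<close> for the summands and at \<open>c = 1\<close>
      for the last term. The chain rule factor \<open>- c\<close> meets the \<open>p i\<close>
      already in front and produces the squares in \<open>K2\<close>.\<close>
    have D: "((\<lambda>s. Digamma ((\<alpha> - s) * c)) has_field_derivative - (c * Polygamma 1 (\<alpha> * c))) (at 0)"
      if "0 < c" for c
    proof -
      have "((\<lambda>s. (\<alpha> - s) * c) has_field_derivative - c) (at 0)"
        by (auto intro!: derivative_eq_intros)
      moreover have "(Digamma has_field_derivative Polygamma 1 (\<alpha> * c)) (at ((\<alpha> - 0) * c))"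
        using deriv_Digamma_eq_trigamma[of "\<alpha> * c"] \<alpha> that by simp
      ultimately have "((\<lambda>s. Digamma ((\<alpha> - s) * c)) has_field_derivative Polygamma 1 (\<alpha> * c) * - c) (at 0)"
        by (rule DERIV_chain2[rotated])
      then show ?thesis by (simp only: mult_minus_left mult_minus_right mult.commute)
    qed
    have "((\<lambda>s. \<Sum>i\<in>{1..n}. p i * Digamma ((\<alpha> - s) * p i)) has_field_derivative
        (\<Sum>i\<in>{1..n}. p i * - (p i * Polygamma 1 (\<alpha> * p i)))) (at 0)"
      using p by (intro DERIV_sum DERIV_cmult D)
    moreover have "((\<lambda>s. Digamma (\<alpha> - s)) has_field_derivative - Polygamma 1 \<alpha>) (at 0)"
      using D[of 1] by simp
    ultimately have "(K1 has_field_derivative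
        0 - (\<Sum>i\<in>{1..n}. p i * - (p i * Polygamma 1 (\<alpha> * p i))) + - Polygamma 1 \<alpha>) (at 0)"
      unfolding K1_def by (intro DERIV_add DERIV_diff DERIV_const)
    then show ?thesis
      by (simp add: K2_def sum_negf power2_eq_square mult.assoc)
  qed
  note moments = moments_from_cgf[OF X \<alpha> mgf[THEN conjunct1] mgf[THEN conjunct2] K_deriv K1_deriv]
  \<comment> \<open>Since the \<open>p i\<close> sum to 1, the single
    \<open>Digamma \<alpha>\<close> can be distributed over the sum.\<close>
  have "K1 0 = H n p - (\<Sum>i\<in>{1..n}. p i * (Digamma (\<alpha> * p i) - Digamma \<alpha>))"
    by (simp add: K1_def right_diff_distrib sum_subtractf sum_p flip: sum_distrib_right)
  then show ?thesis
    using X_AE moments unfolding X_def K2_def by simp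
qed

end
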